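(* Let $r\ge n\ge 2$ be integers, let $F$ be a field with $\#F\ge r$, and let $m=(m_1,\dots,m_n)\in\mathbb{N}_{>0}^n$. Let $X\subset\mathbb{A}^n_F$ be an essential arrangement of $r$ distinct toric branches, the $i$-th of which is parameterized by $t_i\mapsto (v_{i,1}t_i^{m_1},\dots,v_{i,n}t_i^{m_n})$ with $v_{i,j}\in F$ (the exponent vector $m$ being the same for all branches). Then the value semiring ${\rm S}(X)\subset\overline{\mathbb{N}}^r$ is generated, as a semiring, by the set of all $\pi_X(f)$, where $d$ ranges over all positive integers and $f$ ranges over the $d$-forms of minimal nonempty support.
   Context: $\overline{\mathbb{N}}=\mathbb{N}\cup\{\infty\}$. $\overline{\mathbb{N}}^r$ is the idempotent semiring with addition $a\oplus b=(\min\{a_1,b_1\},\dots,\min\{a_r,b_r\})$, additive identity $\boldsymbol{\infty}=(\infty,\dots,\infty)$, multiplication $a\odot b=(a_1+b_1,\dots,a_r+b_r)$, and multiplicative identity $\mathbf{0}=(0,\dots,0)$. A subset $G$ of a subsemiring ${\rm S}\subset\overline{\mathbb{N}}^r$ generates ${\rm S}$ if ${\rm S}$ is the smallest subset of $\overline{\mathbb{N}}^r$ containing $G\cup\{\mathbf{0},\boldsymbol{\infty}\}$ and closed under $\oplus$ and $\odot$. The support of $a\in\overline{\mathbb{N}}^r$ is $\{i\in\{1,\dots,r\}: a_i\ne\infty\}$. Write $v_i=(v_{i,1},\dots,v_{i,n})\in F^n$. The arrangement is essential if $v_1,\dots,v_r$ span $F^n$. Let $\mu_A:F[x_1,\dots,x_n]\to\prod_{i=1}^rF[[t_i]]$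 be the $F$-algebra homomorphism with $x_j\mapsto(v_{1,j}t_1^{m_j},\dots,v_{r,j}t_r^{m_j})$ for $j=1,\dots,n$. Let $\pi_X(f)=(\mathrm{ord}_{t_1}(\mu_A(f)_1),\dots,\mathrm{ord}_{t_r}(\mu_A(f)_r))\in\overline{\mathbb{N}}^r$, where $\mathrm{ord}_t$ is the $t$-adic valuation with $\mathrm{ord}_t(0)=\infty$. The value semiring of $X$ (at the origin) is ${\rm S}(X)=\pi_X(F[x_1,\dots,x_n])$. For $d\in\mathbb{N}$ let $R(d)=\bigoplus_{I\in\mathbb{N}^n:\ \langle I,m\rangle=d}F\,x^I$, where $\langle I,m\rangle=\sum_j i_jm_j$. A $d$-form of minimal nonempty support is an element $f\in R(d)$ such that the support of $\pi_X(f)$ is nonempty and is minimal with respect to inclusion among the nonempty supports of elements $\pi_X(g)$, $g\in R(d)$. *)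

theory Defs
  imports "HOL-Analysis.Cartesian_Space" "HOL-Library.Poly_Mapping" "HOL-Library.Extended_Nat"
    "HOL-Computational_Algebra.Formal_Power_Series"
begin

section \<open>The idempotent semiring of r-tuples over the extended naturals\<close>

definition trop_add :: "enat ^ 'r \<Rightarrow> enat ^ 'r \<Rightarrow> enat ^ 'r" where
  "trop_add a b = (\<chi> i. min (a $ i) (b $ i))"

definition trop_mult :: "enat ^ 'r \<Rightarrow> enat ^ 'r \<Rightarrow> enat ^ 'r" where
  "trop_mult a b = (\<chi> i. a $ i + b $ i)"

definition trop_zero :: "enat ^ 'r" where
  "trop_zero = (\<chi> i. \<infinity>)"

definition trop_one :: "enat ^ 'r" where
  "trop_one = (\<chi> i. 0)"

definition subsemiring :: "(enat ^ 'r) set \<Rightarrow> bool" where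
  "subsemiring S \<longleftrightarrow> trop_one \<in> S \<and> trop_zero \<in> S \<and>
     (\<forall>a\<in>S. \<forall>b\<in>S. trop_add a b \<in> S \<and> trop_mult a b \<in> S)"

definition generates :: "(enat ^ 'r) set \<Rightarrow> (enat ^ 'r) set \<Rightarrow> bool" where
  "generates G S \<longleftrightarrow> subsemiring S \<and> G \<subseteq> S \<and>
     (\<forall>T. subsemiring T \<and> G \<subseteq> T \<longrightarrow> S \<subseteq> T)"

definition supp :: "enat ^ 'r \<Rightarrow> 'r set" where
  "supp a = {i. a $ i \<noteq> \<infinity>}"

section \<open>Arrangements of toric branches\<close>

text \<open>The polynomial ring in variables indexed by \<open>'n\<close>: finitely supported
  coefficient functions on exponent vectors, multiplied by convolution.\<close>

type_synonym ('n, 'a) mpoly = "('n \<Rightarrow>\<^sub>0 nat) \<Rightarrow>\<^sub>0 'a"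

text \<open>The \<open>i\<close>-th component is the substitution \<open>x\<^sub>j \<mapsto> v\<^sub>i\<^sub>j t\<^bsup>m j\<^esup>\<close>; the lemmas below
  record that it is the \<open>F\<close>-algebra homomorphism determined by these images.\<close>

definition mu :: "('r::finite \<Rightarrow> 'a::field ^ 'n::finite) \<Rightarrow> nat ^ 'n \<Rightarrow> ('n, 'a) mpoly \<Rightarrow> 'r \<Rightarrow> 'a fps" where
  "mu v m f i = (\<Sum>I\<in>Poly_Mapping.keys f. fps_const (Poly_Mapping.lookup f I) *
     (\<Prod>j\<in>UNIV. (fps_const (v i $ j) * fps_X ^ (m $ j)) ^ Poly_Mapping.lookup I j))"

lemma mu_superset:
  assumes "finite K" "Poly_Mapping.keys f \<subseteq> K"
  shows "mu v m f i = (\<Sum>I\<in>K. fps_const (Poly_Mapping.lookup f I) *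
     (\<Prod>j\<in>UNIV. (fps_const (v i $ j) * fps_X ^ (m $ j)) ^ Poly_Mapping.lookup I j))"
  unfolding mu_def using assms
  by (intro sum.mono_neutral_left) (auto simp: in_keys_iff)

lemma mu_const: "mu v m (Poly_Mapping.single 0 c) i = fps_const c"
  by (auto simp: mu_def)

lemma mu_var:
  "mu v m (Poly_Mapping.single (Poly_Mapping.single j 1) 1) i = fps_const (v i $ j) * fps_X ^ (m $ j)"
proof -
  have "(\<Prod>k\<in>UNIV. (fps_const (v i $ k) * fps_X ^ (m $ k)) ^ Poly_Mapping.lookup (Poly_Mapping.single j 1) k)
      = (\<Prod>k\<in>UNIV. if k = j then fps_const (v i $ k) * fps_X ^ (m $ k) else 1)"
    by (intro prod.cong) (auto simp: lookup_single)
  then show ?thesis by (simp add: mu_def)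
qed

lemma mu_add: "mu v m (f + g) i = mu v m f i + mu v m g i"
proof -
  let ?K = "Poly_Mapping.keys f \<union> Poly_Mapping.keys g"
  have "Poly_Mapping.keys (f + g) \<subseteq> ?K" by (rule Poly_Mapping.keys_add)
  then show ?thesis
    by (simp add: mu_superset[where K = ?K] lookup_add sum.distrib
        fps_const_add[symmetric] distrib_right del: fps_const_add)
qed

lemma mu_sum: "finite A \<Longrightarrow> mu v m (\<Sum>k\<in>A. f k) i = (\<Sum>k\<in>A. mu v m (f k) i)"
  by (induction A rule: finite_induct) (auto simp: mu_add, simp add: mu_def)

lemma mu_monom: "mu v m (Poly_Mapping.single I c) i = fps_const c *
     (\<Prod>j\<in>UNIV. (fps_const (v i $ j) * fps_X ^ (m $ j)) ^ Poly_Mapping.lookup I j)"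
  by (auto simp: mu_def)

lemma mu_mult:
  fixes f g :: "('n::finite, 'a::field) mpoly"
  shows "mu v m (f * g) i = mu v m f i * mu v m g i"
proof -
  have expand: "h = (\<Sum>I\<in>Poly_Mapping.keys h. Poly_Mapping.single I (Poly_Mapping.lookup h I))"
    for h :: "('n, 'a) mpoly"
    by (rule poly_mapping_eqI)
      (auto simp: lookup_sum lookup_single when_def in_keys_iff)
  have "f * g = (\<Sum>I\<in>Poly_Mapping.keys f. \<Sum>J\<in>Poly_Mapping.keys g.
      Poly_Mapping.single (I + J) (Poly_Mapping.lookup f I * Poly_Mapping.lookup g J))"
    by (subst expand[of f], subst expand[of g]) (simp add: sum_product mult_single)
  then have "mu v m (f * g) i = (\<Sum>I\<in>Poly_Mapping.keys f. \<Sum>J\<in>Poly_Mapping.keys g.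
      mu v m (Poly_Mapping.single I (Poly_Mapping.lookup f I)) i *
      mu v m (Poly_Mapping.single J (Poly_Mapping.lookup g J)) i)"
    by (simp add: mu_sum mu_monom lookup_add power_add prod.distrib
        fps_const_mult[symmetric] mult_ac del: fps_const_mult)
  also have "\<dots> = mu v m f i * mu v m g i"
    unfolding sum_product[symmetric] by (simp add: mu_monom) (simp add: mu_def)
  finally show ?thesis .
qed

text \<open>Unlike \<open>subdegree\<close>, this sends 0 to infinity.\<close>

definition fps_ord :: "'a::zero fps \<Rightarrow> enat" where
  "fps_ord p = (if p = 0 then \<infinity> else enat (subdegree p))"

definition value_vec :: "('r::finite \<Rightarrow> 'a::field ^ 'n::finite) \<Rightarrow> nat ^ 'n \<Rightarrow> ('n, 'a) mpoly \<Rightarrow> enat ^ 'r" where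
  "value_vec v m f = (\<chi> i. fps_ord (mu v m f i))"

definition value_semiring :: "('r::finite \<Rightarrow> 'a::field ^ 'n::finite) \<Rightarrow> nat ^ 'n \<Rightarrow> (enat ^ 'r) set" where
  "value_semiring v m = range (value_vec v m)"

text \<open>The prime ideal of the \<open>i\<close>-th branch. Different coefficient vectors may parameterize the
  same branch, so distinctness of branches is distinctness of these ideals.\<close>

definition branch_ideal :: "('r::finite \<Rightarrow> 'a::field ^ 'n::finite) \<Rightarrow> nat ^ 'n \<Rightarrow> 'r \<Rightarrow> ('n, 'a) mpoly set" where
  "branch_ideal v m i = {f. mu v m f i = 0}"

text \<open>The condition \<open>v i \<noteq> 0\<close> says that the parameterization is not constant, so that it
  does parameterize a branch of a curve.\<close>

definition distinct_branches :: "('r::finite \<Rightarrow> 'a::field ^ 'n::finite) \<Rightarrow> nat ^ 'n \<Rightarrow> bool" where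
  "distinct_branches v m \<longleftrightarrow> (\<forall>i. v i \<noteq> 0) \<and> inj (branch_ideal v m)"

definition essential :: "('r::finite \<Rightarrow> 'a::field ^ 'n::finite) \<Rightarrow> bool" where
  "essential v \<longleftrightarrow> vec.span (range v) = UNIV"

definition forms :: "nat ^ 'n::finite \<Rightarrow> nat \<Rightarrow> ('n, 'a::field) mpoly set" where
  "forms m d = {f. \<forall>I\<in>Poly_Mapping.keys f. (\<Sum>j\<in>UNIV. Poly_Mapping.lookup I j * m $ j) = d}"

definition minimal_form ::
  "('r::finite \<Rightarrow> 'a::field ^ 'n::finite) \<Rightarrow> nat ^ 'n \<Rightarrow> nat \<Rightarrow> ('n, 'a) mpoly \<Rightarrow> bool" where
  "minimal_form v m d f \<longleftrightarrow> f \<in> forms m d \<and> supp (value_vec v m f) \<noteq> {} \<and>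
     (\<forall>g\<in>forms m d. supp (value_vec v m g) \<noteq> {} \<and>
        supp (value_vec v m g) \<subseteq> supp (value_vec v m f) \<longrightarrow>
        supp (value_vec v m g) = supp (value_vec v m f))"

end

(* The value of a polynomial is the minimum of the values of its weighted homogeneous components,
   and on a d-form f the i-th branch takes a value c * t^d. So the forms of degree d induce a linear
   space of vectors (c_1, ..., c_r), and in a linear space the support of every vector is a union of
   minimal nonempty supports (as in a matroid, by elimination). *)

theory Submission
  imports Defs
begin

section \<open>Orders of power series\<close>

text \<open>Describing the order by its lower bounds treats the zero series uniformly and lets
  orders be compared with infima of orders.\<close>

lemma le_fps_ord_iff: "k \<le> fps_ord p \<longleftrightarrow> (\<forall>n. fps_nth p n \<noteq> 0 \<longrightarrow> k \<le> enat n)"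
proof (cases "p = 0")
  case False
  show ?thesis
  proof
    assume "k \<le> fps_ord p"
    with False have "k \<le> enat (subdegree p)" by (simp add: fps_ord_def)
    then show "\<forall>n. fps_nth p n \<noteq> 0 \<longrightarrow> k \<le> enat n"
      by (meson enat_ord_simps(1) order_trans subdegree_leI)
  qed (use False in \<open>simp add: fps_ord_def\<close>)
qed (simp add: fps_ord_def)

lemma fps_ord_eqI:
  assumes "\<And>k. k < n \<Longrightarrow> fps_nth p k = 0" "fps_nth p n \<noteq> 0"
  shows "fps_ord p = enat n"
  using assms by (metis fps_nonzero_nth fps_ord_def subdegreeI)

lemma fps_ord_mult:
  fixes p q :: "'a::field fps"
  shows "fps_ord (p * q) = fps_ord p + fps_ord q"
  by (simp add: fps_ord_def)

lemma fps_ord_eq_infinity_iff [simp]: "fps_ord p = \<infinity> \<longleftrightarrow> p = 0"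
  by (simp add: fps_ord_def)

text \<open>Where the first order is strictly smaller, no scalar causes cancellation. This saves one
  scalar in the counting argument for sums.\<close>

lemma fps_ord_add_const_mult_less:
  fixes p q :: "'a::field fps"
  assumes "fps_ord p < fps_ord q"
  shows "fps_ord (p + fps_const c * q) = fps_ord p"
proof -
  from assms obtain n where n: "fps_ord p = enat n"
    by (cases "fps_ord p") auto
  have p: "fps_nth p k = 0" if "k < n" for k
    using that le_fps_ord_iff[of "fps_ord p" p] n by fastforce
  have q: "fps_nth q k = 0" if "k \<le> n" for k
  proof (rule ccontr)
    assume "fps_nth q k \<noteq> 0"
    then have "fps_ord q \<le> enat k" using le_fps_ord_iff by blast
    also have "\<dots> \<le> fps_ord p" using that n by simp
    finally show False using assms by simp
  qed
  have "fps_nth p n \<noteq> 0"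
    using n by (auto simp: fps_ord_def split: if_splits)
  with p q n show ?thesis by (auto intro!: fps_ord_eqI)
qed

text \<open>At the smaller order \<open>n\<close> the coefficient of the combination is affine in
  \<open>c\<close> and not identically zero, so at most one scalar makes it vanish. If both series
  are zero, any \<open>b\<close> will do.\<close>

lemma fps_ord_add_const_mult_generic:
  fixes p q :: "'a::field fps"
  shows "\<exists>b. \<forall>c. c \<noteq> b \<longrightarrow> fps_ord (p + fps_const c * q) = min (fps_ord p) (fps_ord q)"
proof (cases "min (fps_ord p) (fps_ord q)")
  case (enat n)
  \<comment> \<open>The root of the affine function of \<open>c\<close>. If
    \<open>fps_nth q n = 0\<close>, division by zero gives the harmless value 0: then
    \<open>fps_nth p n \<noteq> 0\<close> and no scalar cancels.\<close>
  define b where "b = - fps_nth p n / fps_nth q n"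
  have z: "fps_nth p k = 0 \<and> fps_nth q k = 0" if "k < n" for k
    using that enat le_fps_ord_iff[of "enat n" p] le_fps_ord_iff[of "enat n" q]
    by (metis enat_ord_simps(1) leD min.cobounded1 min.cobounded2)
  have nz: "fps_nth p n \<noteq> 0 \<or> fps_nth q n \<noteq> 0"
    using enat by (auto simp: fps_ord_def min_def split: if_splits)
  have "fps_ord (p + fps_const c * q) = enat n" if "c \<noteq> b" for c
  proof (rule fps_ord_eqI)
    show "fps_nth (p + fps_const c * q) n \<noteq> 0"
      using nz that
      by (cases "fps_nth q n = 0") (auto simp: b_def field_simps eq_neg_iff_add_eq_0)
  qed (use z in auto)
  with enat show ?thesis by auto
qed (auto simp: min_def split: if_splits)

section \<open>The value semiring is a semiring\<close>

lemma value_vec_nth: "value_vec v m f $ i = fps_ord (mu v m f i)"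
  by (simp add: value_vec_def)

lemma supp_value_vec: "supp (value_vec v m f) = {i. mu v m f i \<noteq> 0}"
  by (simp add: supp_def value_vec_nth)

text \<open>Scalars act through constant polynomials. Combinations of this shape serve twice: with a
  generic scalar to realize tropical sums, with a special one to eliminate a coordinate.\<close>

lemma mu_add_scale:
  "mu v m (f + Poly_Mapping.single 0 c * g) i = mu v m f i + fps_const c * mu v m g i"
  by (simp add: mu_add mu_mult mu_const)

lemma value_vec_single_0:
  "value_vec v m (Poly_Mapping.single 0 c) = (if c = 0 then trop_zero else trop_one)"
  by (auto simp: vec_eq_iff value_vec_nth mu_const fps_ord_def trop_zero_def trop_one_def
      zero_enat_def)

text \<open>A combination \<open>f + c g\<close> realizes the sum unless \<open>c\<close> is the bad
  scalar of some coordinate. Avoiding \<open>r\<close> bad scalars would take more than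
  \<open>r\<close> field elements; but either \<open>g\<close> alone realizes the sum, or some
  coordinate has no bad scalar. The cardinality hypothesis is a disjunction because
  \<open>CARD\<close> of an infinite type is 0.\<close>

lemma trop_add_in_value_semiring:
  fixes v :: "'r::finite \<Rightarrow> 'a::field ^ 'n::finite"
  assumes card: "infinite (UNIV :: 'a set) \<or> CARD('r) \<le> CARD('a)"
  shows "trop_add (value_vec v m f) (value_vec v m g) \<in> value_semiring v m"
proof (cases "\<forall>i. fps_ord (mu v m g i) \<le> fps_ord (mu v m f i)")
  case True
  then have "trop_add (value_vec v m f) (value_vec v m g) = value_vec v m g"
    by (simp add: trop_add_def vec_eq_iff value_vec_nth min_absorb2)
  then show ?thesis by (simp add: value_semiring_def)
next
  case False
  then obtain i0 where i0: "fps_ord (mu v m f i0) < fps_ord (mu v m g i0)"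
    by (auto simp: not_le)
  have "\<forall>i. \<exists>b. \<forall>c. c \<noteq> b \<longrightarrow>
      fps_ord (mu v m f i + fps_const c * mu v m g i)
        = min (fps_ord (mu v m f i)) (fps_ord (mu v m g i))"
    using fps_ord_add_const_mult_generic by blast
  then obtain b where b: "\<And>i c. c \<noteq> b i \<Longrightarrow>
      fps_ord (mu v m f i + fps_const c * mu v m g i)
        = min (fps_ord (mu v m f i)) (fps_ord (mu v m g i))"
    unfolding choice_iff by blast
  \<comment> \<open>At \<open>i0\<close> no scalar is bad, so one of \<open>r\<close> scalars avoids all bad ones.\<close>
  have "b ` (UNIV - {i0}) \<noteq> UNIV"
  proof
    assume eq: "b ` (UNIV - {i0}) = UNIV"
    have "card (b ` (UNIV - {i0})) \<le> card (UNIV - {i0})"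
      by (rule card_image_le) simp
    also have "\<dots> < CARD('r)"
      by (rule psubset_card_mono) auto
    finally have "CARD('a) < CARD('r)" by (simp add: eq)
    moreover have "finite (UNIV :: 'a set)"
      by (metis eq finite finite_imageI)
    ultimately show False using card by auto
  qed
  then obtain c where c: "\<And>i. i \<noteq> i0 \<Longrightarrow> c \<noteq> b i" by auto
  have "fps_ord (mu v m f i + fps_const c * mu v m g i)
      = min (fps_ord (mu v m f i)) (fps_ord (mu v m g i))" for i
    using b c i0 fps_ord_add_const_mult_less[OF i0, of c] by (cases "i = i0") auto
  then have "trop_add (value_vec v m f) (value_vec v m g)
      = value_vec v m (f + Poly_Mapping.single 0 c * g)"
    by (simp add: trop_add_def vec_eq_iff value_vec_nth mu_add_scale)
  then show ?thesis by (simp add: value_semiring_def)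
qed

lemma subsemiring_value_semiring:
  fixes v :: "'r::finite \<Rightarrow> 'a::field ^ 'n::finite"
  assumes "infinite (UNIV :: 'a set) \<or> CARD('r) \<le> CARD('a)"
  shows "subsemiring (value_semiring v m)"
proof -
  have "trop_mult (value_vec v m f) (value_vec v m g) = value_vec v m (f * g)" for f g
    by (simp add: trop_mult_def vec_eq_iff value_vec_nth mu_mult fps_ord_mult)
  moreover have "trop_one = value_vec v m (Poly_Mapping.single 0 1)"
    by (simp only: value_vec_single_0) simp
  moreover have "trop_zero = value_vec v m (Poly_Mapping.single 0 0)"
    by (simp only: value_vec_single_0) simp
  ultimately show ?thesis
    using trop_add_in_value_semiring[OF assms, of v m]
    unfolding subsemiring_def value_semiring_def by auto
qed

text \<open>Iterated tropical addition; the empty infimum is \<open>trop_zero\<close>, which covers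
  empty supports and the zero polynomial.\<close>

lemma subsemiring_INF:
  fixes b :: "'k \<Rightarrow> enat ^ 'r"
  assumes "subsemiring T" "finite A" "\<And>a. a \<in> A \<Longrightarrow> b a \<in> T"
  shows "(\<chi> i. INF a\<in>A. b a $ i) \<in> T"
  using assms(2,3)
proof (induction A rule: finite_induct)
  case empty
  then show ?case
    using assms(1) by (simp add: subsemiring_def trop_zero_def top_enat_def)
next
  case (insert x A)
  have "(\<chi> i. INF a\<in>insert x A. b a $ i) = trop_add (b x) (\<chi> i. INF a\<in>A. b a $ i)"
    by (simp add: vec_eq_iff trop_add_def inf_min)
  with insert show ?case using assms(1) by (simp add: subsemiring_def)
qed

section \<open>Weighted homogeneous forms\<close>

lemma fps_const_prod:
  fixes g :: "'k \<Rightarrow> 'a::comm_semiring_1"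
  shows "fps_const (\<Prod>j\<in>A. g j) = (\<Prod>j\<in>A. fps_const (g j))"
  by (induction A rule: infinite_finite_induct)
    (auto simp: fps_const_mult[symmetric] simp del: fps_const_mult)

lemma fps_const_sum:
  fixes g :: "'k \<Rightarrow> 'a::comm_semiring_1"
  shows "fps_const (\<Sum>j\<in>A. g j) = (\<Sum>j\<in>A. fps_const (g j))"
  by (induction A rule: infinite_finite_induct)
    (auto simp: fps_const_add[symmetric] simp del: fps_const_add)

text \<open>Every monomial of weight \<open>d\<close> contributes a multiple of the same power of
  \<open>t\<close>; the constant \<open>c\<close> is the value of \<open>f\<close> at the point
  \<open>v i\<close>.\<close>

lemma mu_form:
  assumes "f \<in> forms m d"
  shows "\<exists>c. mu v m f i = fps_const c * fps_X ^ d"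
proof -
  let ?c = "\<lambda>I. Poly_Mapping.lookup f I * (\<Prod>j\<in>UNIV. (v i $ j) ^ Poly_Mapping.lookup I j)"
  have mon: "(\<Prod>j\<in>UNIV. (fps_const (v i $ j) * fps_X ^ (m $ j)) ^ Poly_Mapping.lookup I j)
      = fps_const (\<Prod>j\<in>UNIV. (v i $ j) ^ Poly_Mapping.lookup I j) * fps_X ^ d"
    if "I \<in> Poly_Mapping.keys f" for I
  proof -
    have "(\<Sum>j\<in>UNIV. Poly_Mapping.lookup I j * m $ j) = d"
      using assms that by (simp add: forms_def)
    then show ?thesis
      by (simp add: fps_const_prod power_mult_distrib prod.distrib power_mult[symmetric]
          power_sum[symmetric] mult.commute[of "m $ _"])
  qed
  have "mu v m f i = (\<Sum>I\<in>Poly_Mapping.keys f. fps_const (?c I) * fps_X ^ d)"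
    unfolding mu_def
    by (intro sum.cong)
      (simp_all add: mon fps_const_mult[symmetric] mult.assoc del: fps_const_mult)
  also have "\<dots> = fps_const (\<Sum>I\<in>Poly_Mapping.keys f. ?c I) * fps_X ^ d"
    by (simp add: sum_distrib_right[symmetric] fps_const_sum)
  finally show ?thesis by blast
qed

lemma mu_form_nth:
  assumes "f \<in> forms m d" "n \<noteq> d"
  shows "fps_nth (mu v m f i) n = 0"
  using mu_form[OF assms(1), of v i] assms(2) by auto

text \<open>In a fixed degree the value is determined by its support, so tropical addition of such
  values amounts to union of supports.\<close>

lemma value_vec_form:
  assumes "f \<in> forms m d"
  shows "value_vec v m f $ i = (if i \<in> supp (value_vec v m f) then enat d else \<infinity>)"
  using mu_form[OF assms, of v i]
  by (auto simp: supp_value_vec value_vec_nth intro!: fps_ord_eqI)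

lemma forms_add_scale:
  assumes "f \<in> forms m d" "g \<in> forms m d"
  shows "f + Poly_Mapping.single 0 c * g \<in> forms m d"
proof -
  have "Poly_Mapping.keys (Poly_Mapping.single 0 c * g) \<subseteq> Poly_Mapping.keys g"
    using keys_mult[of "Poly_Mapping.single 0 c" g] by (fastforce split: if_splits)
  then have "Poly_Mapping.keys (f + Poly_Mapping.single 0 c * g)
      \<subseteq> Poly_Mapping.keys f \<union> Poly_Mapping.keys g"
    using Poly_Mapping.keys_add[of f "Poly_Mapping.single 0 c * g"] by blast
  with assms show ?thesis unfolding forms_def by blast
qed

section \<open>Minimal supports and the values of forms of a fixed degree\<close>

text \<open>Induction on the size of the support: a form that is not minimal can be replaced by one
  of strictly smaller support that still contains \<open>e\<close>.\<close>

lemma minimal_form_through: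
  assumes "f \<in> forms m d" "e \<in> supp (value_vec v m f)"
  shows "\<exists>g. minimal_form v m d g \<and> e \<in> supp (value_vec v m g)
    \<and> supp (value_vec v m g) \<subseteq> supp (value_vec v m f)"
  using assms
proof (induction "card (supp (value_vec v m f))" arbitrary: f rule: less_induct)
  case less
  show ?case
  proof (cases "minimal_form v m d f")
    case False
    with less.prems obtain g where g: "g \<in> forms m d" "supp (value_vec v m g) \<noteq> {}"
        "supp (value_vec v m g) \<subset> supp (value_vec v m f)"
      unfolding minimal_form_def by blast
    have "\<exists>h\<in>forms m d. e \<in> supp (value_vec v m h) \<and>
        supp (value_vec v m h) \<subset> supp (value_vec v m f)"
    proof (cases "e \<in> supp (value_vec v m g)")
      case False
      obtain k where k: "k \<in> supp (value_vec v m g)" using g by blast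
      obtain x where x: "mu v m f k = fps_const x * fps_X ^ d"
        using mu_form less.prems by blast
      obtain y where y: "mu v m g k = fps_const y * fps_X ^ d"
        using mu_form g by blast
      have y0: "y \<noteq> 0" using k y by (auto simp: supp_value_vec)
      \<comment> \<open>The scalar is chosen to cancel coordinate \<open>k\<close>. Coordinate
        \<open>e\<close> survives because \<open>g\<close> vanishes there, and no new coordinate
        appears because the support of \<open>g\<close> lies inside that of
        \<open>f\<close>.\<close>
      define h where "h = f + Poly_Mapping.single 0 (- x / y) * g"
      have mu_h: "mu v m h i = mu v m f i + fps_const (- x / y) * mu v m g i" for i
        by (simp only: h_def mu_add_scale)
      have "mu v m h k = (fps_const x + fps_const (- x / y) * fps_const y) * fps_X ^ d"
        unfolding mu_h x y by (simp only: distrib_right mult.assoc)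
      also have "\<dots> = 0" using y0 by simp
      finally have "k \<notin> supp (value_vec v m h)" by (simp add: supp_value_vec)
      moreover have "supp (value_vec v m h) \<subseteq> supp (value_vec v m f)"
        using g(3) mu_h by (auto simp: supp_value_vec)
      moreover have "e \<in> supp (value_vec v m h)"
        using False less.prems(2) mu_h by (auto simp: supp_value_vec)
      moreover have "h \<in> forms m d"
        unfolding h_def using forms_add_scale less.prems(1) g(1) by blast
      ultimately show ?thesis using k g(3) by blast
    qed (use g in blast)
    then obtain h where h: "h \<in> forms m d" "e \<in> supp (value_vec v m h)"
        "supp (value_vec v m h) \<subset> supp (value_vec v m f)" by blast
    then have "card (supp (value_vec v m h)) < card (supp (value_vec v m f))"
      by (simp add: psubset_card_mono)
    from less.hyps[OF this h(1,2)] h(3) show ?thesis by blast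
  qed (use less.prems in blast)
qed

text \<open>Positive weights leave only the constant monomial in degree 0. This handles the degree
  that the generators omit.\<close>

lemma forms_0:
  fixes f :: "('n::finite, 'a::field) mpoly"
  assumes "\<And>j. m $ j > 0" "f \<in> forms m 0"
  shows "f = Poly_Mapping.single 0 (Poly_Mapping.lookup f 0)"
proof (rule poly_mapping_eqI)
  fix I
  have "I = 0" if "I \<in> Poly_Mapping.keys f"
  proof -
    have "\<forall>j. Poly_Mapping.lookup I j * m $ j = 0"
      using assms(2) that by (simp add: forms_def)
    then have "\<forall>j. Poly_Mapping.lookup I j = 0"
      using assms(1) by (metis less_irrefl mult_eq_0_iff)
    then show ?thesis by (intro poly_mapping_eqI) simp
  qed
  then show "Poly_Mapping.lookup f I
      = Poly_Mapping.lookup (Poly_Mapping.single 0 (Poly_Mapping.lookup f 0)) I"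
    by (cases "I = 0") (auto simp: lookup_single in_keys_iff)
qed

text \<open>In positive degree the support is covered by minimal supports inside it, and the value
  is the infimum of the values of the corresponding minimal forms. Constants have value
  \<open>trop_zero\<close> or \<open>trop_one\<close>.\<close>

lemma value_vec_form_in_subsemiring:
  assumes m: "\<And>j. m $ j > 0" and T: "subsemiring T"
    and G: "\<And>d g. d > 0 \<Longrightarrow> minimal_form v m d g \<Longrightarrow> value_vec v m g \<in> T"
    and f: "f \<in> forms m d"
  shows "value_vec v m f \<in> T"
proof (cases "d = 0")
  case True
  then have "f = Poly_Mapping.single 0 (Poly_Mapping.lookup f 0)"
    using forms_0 m f by blast
  then have "value_vec v m f \<in> {trop_zero, trop_one}"
    by (metis insert_iff value_vec_single_0)
  with T show ?thesis by (auto simp: subsemiring_def)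
next
  case False
  let ?S = "supp (value_vec v m f)"
  have "\<forall>e\<in>?S. \<exists>g. minimal_form v m d g \<and>
      e \<in> supp (value_vec v m g) \<and> supp (value_vec v m g) \<subseteq> ?S"
    using minimal_form_through[OF f] by blast
  then obtain g where g: "\<And>e. e \<in> ?S \<Longrightarrow> minimal_form v m d (g e) \<and>
      e \<in> supp (value_vec v m (g e)) \<and> supp (value_vec v m (g e)) \<subseteq> ?S"
    unfolding bchoice_iff by blast
  have form: "g e \<in> forms m d" if "e \<in> ?S" for e
    using g[OF that] by (simp add: minimal_form_def)
  \<comment> \<open>Both sides take only the values \<open>d\<close> and \<open>\<infinity>\<close>.
    One inequality holds because the minimal supports lie in \<open>?S\<close>, the other because
    they cover it.\<close>
  have "(INF e\<in>?S. value_vec v m (g e) $ i) = value_vec v m f $ i" for i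
  proof (rule antisym)
    show "value_vec v m f $ i \<le> (INF e\<in>?S. value_vec v m (g e) $ i)"
    proof (rule INF_greatest)
      fix e assume "e \<in> ?S"
      with g[OF this] form[OF this] f show "value_vec v m f $ i \<le> value_vec v m (g e) $ i"
        by (auto simp: value_vec_form[of _ m d v i])
    qed
    show "(INF e\<in>?S. value_vec v m (g e) $ i) \<le> value_vec v m f $ i"
    proof (cases "i \<in> ?S")
      case True
      then have "(INF e\<in>?S. value_vec v m (g e) $ i) \<le> value_vec v m (g i) $ i"
        by (rule INF_lower)
      also have "\<dots> = value_vec v m f $ i"
        using g[OF True] form[OF True] f True by (simp add: value_vec_form[of _ m d v i])
      finally show ?thesis .
    qed (simp add: supp_def)
  qed
  moreover have "(\<chi> i. INF e\<in>?S. value_vec v m (g e) $ i) \<in> T"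
    using g False G by (intro subsemiring_INF[OF T]) auto
  ultimately show ?thesis by simp
qed

section \<open>Decomposition into weighted homogeneous components\<close>

text \<open>Components of different degrees contribute different powers of \<open>t\<close> on each
  branch, so they cannot cancel one another.\<close>

lemma value_vec_sum_forms:
  assumes D: "finite D" and p: "\<And>d. d \<in> D \<Longrightarrow> p d \<in> forms m d"
  shows "value_vec v m (\<Sum>d\<in>D. p d) = (\<chi> i. INF d\<in>D. value_vec v m (p d) $ i)"
proof -
  have nth: "fps_nth (mu v m (\<Sum>d\<in>D. p d) i) n
      = (if n \<in> D then fps_nth (mu v m (p n) i) n else 0)" for i n
  proof -
    have "fps_nth (mu v m (\<Sum>d\<in>D. p d) i) n = (\<Sum>d\<in>D. fps_nth (mu v m (p d) i) n)"
      using D by (simp add: mu_sum fps_sum_nth)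
    also have "\<dots> = (\<Sum>d\<in>D. if d = n then fps_nth (mu v m (p n) i) n else 0)"
      by (intro sum.cong) (auto simp: mu_form_nth[OF p])
    finally show ?thesis using D by simp
  qed
  \<comment> \<open>Equality is obtained by showing that both sides have the same lower bounds, with
    no case split on whether the series vanishes.\<close>
  have le: "k \<le> fps_ord (mu v m (\<Sum>d\<in>D. p d) i) \<longleftrightarrow> k \<le> (INF d\<in>D. value_vec v m (p d) $ i)"
    for k i
  proof -
    have "n = d" if "d \<in> D" "fps_nth (mu v m (p d) i) n \<noteq> 0" for d n
      using mu_form_nth[OF p[OF that(1)]] that(2) by blast
    then show ?thesis
      unfolding le_INF_iff value_vec_nth le_fps_ord_iff nth by (auto split: if_splits)
  qed
  have "fps_ord (mu v m (\<Sum>d\<in>D. p d) i) = (INF d\<in>D. value_vec v m (p d) $ i)" for i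
    using le[THEN iffD1, OF order.refl] le[THEN iffD2, OF order.refl] by (rule order.antisym)
  then show ?thesis by (simp add: vec_eq_iff value_vec_def)
qed

lemma ex_sum_forms: "\<exists>D p. finite D \<and> (\<forall>d\<in>D. p d \<in> forms m d) \<and> f = (\<Sum>d\<in>D. p d)"
proof -
  let ?w = "\<lambda>I. \<Sum>j\<in>UNIV. Poly_Mapping.lookup I j * m $ j"
  define p where "p d = (\<Sum>I\<in>{I\<in>Poly_Mapping.keys f. ?w I = d}.
      Poly_Mapping.single I (Poly_Mapping.lookup f I))" for d
  have forms: "p d \<in> forms m d" for d
    unfolding p_def forms_def
    using keys_sum[of "\<lambda>I. Poly_Mapping.single I (Poly_Mapping.lookup f I)"
        "{I\<in>Poly_Mapping.keys f. ?w I = d}"]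
    by (fastforce split: if_splits)
  have "f = (\<Sum>I\<in>Poly_Mapping.keys f. Poly_Mapping.single I (Poly_Mapping.lookup f I))"
    by (rule poly_mapping_eqI) (auto simp: lookup_sum lookup_single when_def in_keys_iff)
  then have sum: "f = (\<Sum>d\<in>?w ` Poly_Mapping.keys f. p d)"
    unfolding p_def by (subst sum.image_gen[symmetric]) auto
  show ?thesis
  proof (intro exI conjI)
    show "finite (?w ` Poly_Mapping.keys f)" by simp
    show "\<forall>d\<in>?w ` Poly_Mapping.keys f. p d \<in> forms m d" using forms by blast
  qed (rule sum)
qed

section \<open>Generation of the value semiring by minimal forms\<close>

theorem theorem1p1:
  fixes v :: "'r::finite \<Rightarrow> 'a::field ^ 'n::finite" and m :: "nat ^ 'n"
  assumes "2 \<le> CARD('n)" and "CARD('n) \<le> CARD('r)"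
    and "infinite (UNIV :: 'a set) \<or> CARD('r) \<le> CARD('a)"
    and "\<And>j. m $ j > 0"
    and "distinct_branches v m" and "essential v"
  shows "generates {value_vec v m f | d f. d > 0 \<and> minimal_form v m d f} (value_semiring v m)"
  unfolding generates_def
proof (intro conjI allI impI)
  show "subsemiring (value_semiring v m)"
    using assms(3) by (rule subsemiring_value_semiring)
  show "{value_vec v m f | d f. d > 0 \<and> minimal_form v m d f} \<subseteq> value_semiring v m"
    by (auto simp: value_semiring_def)
  fix T :: "(enat ^ 'r) set"
  assume T: "subsemiring T \<and> {value_vec v m f | d f. d > 0 \<and> minimal_form v m d f} \<subseteq> T"
  \<comment> \<open>The values of the homogeneous components of \<open>f\<close> lie in
    \<open>T\<close>, and the value of \<open>f\<close> is their finite infimum.\<close>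
  have "value_vec v m f \<in> T" for f
  proof -
    obtain D p where D: "finite D" "\<And>d. d \<in> D \<Longrightarrow> p d \<in> forms m d" "f = (\<Sum>d\<in>D. p d)"
      using ex_sum_forms by metis
    have "value_vec v m (p d) \<in> T" if "d \<in> D" for d
      using T by (intro value_vec_form_in_subsemiring[OF assms(4) _ _ D(2)[OF that]]) auto
    then have "(\<chi> i. INF d\<in>D. value_vec v m (p d) $ i) \<in> T"
      using T D(1) by (intro subsemiring_INF) auto
    then show ?thesis
      unfolding D(3) by (subst value_vec_sum_forms[OF D(1)]) (auto intro: D(2))
  qed
  then show "value_semiring v m \<subseteq> T" by (auto simp: value_semiring_def)
qed

end
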